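(* Let $t \in \bigcup_{k \in \mathbb{N}} (2k-1, 2k)$, where $\mathbb{N} = \{1,2,3,\dots\}$, and let $a > 0$. Then the function $K_{t,a} : \mathbb{R} \times \mathbb{R} \to \mathbb{R}$, $$K_{t,a}(x,y) = \frac{1}{\pi}\cdot\frac{1}{1 + (x-y)^2 + a(x^2+y^2)^t},$$ is not a positive-definite kernel; hence the integral operator $\mathbf{K}_{t,a}$ on $L^2(\mathbb{R})$ with kernel $K_{t,a}$ is not a positive-definite operator.
   Context: For $t>0$, $a>0$, the operator $\mathbf{K}_{t,a} : L^2(\mathbb{R}) \to L^2(\mathbb{R})$ (complex-valued functions) is defined by $\mathbf{K}_{t,a}[c](x) = \int_{\mathbb{R}} K_{t,a}(x,y)\, c(y)\, dy$; it is a bounded (indeed compact) operator on $L^2(\mathbb{R})$. For a nonempty set $X$, a function $K : X \times X \to \mathbb{C}$ is called a positive-definite kernel if $\sum_{j=1}^n \sum_{k=1}^n c_j \overline{c_k} K(x_j,x_k) \geq 0$ for all $n \in \mathbb{N}$, all $(x_1,\dots,x_n) \in X^n$ and all $(c_1,\dots,c_n)\in\mathbb{C}^n$ (so "positive-definite" is meant in the non-strict sense). The operator $\mathbf{K}_{t,a}$ is called positive-definite if $\langle \mathbf{K}_{t,a}[c], c\rangle = \iint_{\mathbb{R}\times\mathbb{R}} K_{t,a}(x,y)\, c(x)\overline{c(y)}\, dy\, dx \geq 0$ for all $c \in L^2(\mathbb{R})$. Convention: $0^t = 0$ for $t>0$. *)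

theory Defs
  imports "HOL-Analysis.Analysis"
begin

(* Membership in nonneg_Reals says that a complex number is real and nonnegative. *)
definition positive_definite_kernel :: "'a set \<Rightarrow> ('a \<Rightarrow> 'a \<Rightarrow> complex) \<Rightarrow> bool" where
  "positive_definite_kernel X K \<longleftrightarrow>
     (\<forall>n\<ge>1. \<forall>x :: nat \<Rightarrow> 'a. \<forall>c :: nat \<Rightarrow> complex.
        (\<forall>j\<in>{1..n}. x j \<in> X) \<longrightarrow>
        (\<Sum>j=1..n. \<Sum>k=1..n. c j * cnj (c k) * K (x j) (x k)) \<in> \<real>\<^sub>\<ge>\<^sub>0)"

(* L^2(R) is represented by its functions rather than by their classes modulo null sets. Borel
   measurability is enough: each class has a Borel representative, and the integrals below do
   not depend on the representative. *)
definition L2 :: "(real \<Rightarrow> complex) set" where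
  "L2 = {c. c \<in> borel_measurable lborel \<and> integrable lborel (\<lambda>x. (cmod (c x))\<^sup>2)}"

definition L2_inner :: "(real \<Rightarrow> complex) \<Rightarrow> (real \<Rightarrow> complex) \<Rightarrow> complex" where
  "L2_inner f g = (LINT x|lborel. f x * cnj (g x))"

definition integral_operator ::
    "(real \<Rightarrow> real \<Rightarrow> complex) \<Rightarrow> (real \<Rightarrow> complex) \<Rightarrow> (real \<Rightarrow> complex)" where
  "integral_operator K c = (\<lambda>x. LINT y|lborel. K x y * c y)"

definition positive_definite_operator ::
    "((real \<Rightarrow> complex) \<Rightarrow> (real \<Rightarrow> complex)) \<Rightarrow> bool" where
  "positive_definite_operator T \<longleftrightarrow> (\<forall>c\<in>L2. L2_inner (T c) c \<in> \<real>\<^sub>\<ge>\<^sub>0)"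

(* In HOL, 0 powr t = 0, so the kernel is 1 / pi at the origin, as intended for t > 0. *)
definition K_kernel :: "real \<Rightarrow> real \<Rightarrow> real \<Rightarrow> real \<Rightarrow> real" where
  "K_kernel t a x y = (1 / pi) * (1 / (1 + (x - y)\<^sup>2 + a * (x\<^sup>2 + y\<^sup>2) powr t))"

end

theory Submission
  imports Defs
begin

text \<open>
  Near the origin the kernel is \<open>1/\<pi>\<close> times a power series in \<open>(x - y)\<^sup>2\<close>, perturbed to first
  order by \<open>- a (x\<^sup>2 + y\<^sup>2)\<^sup>t\<close>. Let \<open>2k - 1 < t < 2k\<close>, and take finitely many points \<open>p\<^sub>i\<close> with
  real weights \<open>w\<^sub>i\<close> such that \<open>\<Sum>\<^sub>i w\<^sub>i p\<^sub>i\<^sup>m = 0\<close> for all \<open>m < 2k\<close>. Every monomial of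
  \<open>(x - y)\<^sup>2\<^sup>l\<close> with \<open>l < 2k\<close> has an exponent below \<open>2k\<close> in one of the two variables, so the
  quadratic form of the weights annihilates these powers (\<open>moment_free_difference_power\<close>). If the
  points are shrunk by a factor \<open>\<epsilon>\<close>, the remaining powers of \<open>(x - y)\<^sup>2\<close> contribute \<open>O(\<epsilon>\<^sup>4\<^sup>k)\<close>,
  which is negligible against \<open>\<epsilon>\<^sup>2\<^sup>t\<close>. Divided by \<open>\<epsilon>\<^sup>2\<^sup>t\<close>, the quadratic form of \<open>\<pi> K\<close>
  therefore tends to \<open>- a \<Sum>\<^sub>i\<^sub>,\<^sub>j w\<^sub>i w\<^sub>j (p\<^sub>i\<^sup>2 + p\<^sub>j\<^sup>2)\<^sup>t\<close> (\<open>kernel_scaling_limit\<close>), and the kernel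
  fails to be positive definite as soon as this last double sum is positive.

  Such weights come from finite differences (\<open>exists_moment_free_configuration\<close>). Put the weights
  \<open>(-1)\<^sup>k\<^sup>+\<^sup>i (k choose i)\<close> of the \<open>k\<close>-th difference at both points \<open>\<plusminus>\<surd>i\<close>, \<open>i \<le> k\<close>. The odd moments
  vanish by symmetry and the even ones because \<open>k\<close>-th differences kill polynomials of degree below
  \<open>k\<close>. The double sum is four times the difference of order \<open>2k\<close> of \<open>s\<^sup>t\<close> at \<open>0\<close>; by the mean
  value theorem it has the sign of \<open>t (t - 1) \<dots> (t - 2k + 1)\<close>, which is positive since
  \<open>t > 2k - 1\<close>.

  For the operator, each point mass is replaced by the indicator function of a short interval.
  By continuity of the kernel the quadratic form stays negative
  (\<open>negative_quadratic_form_imp_not_positive_definite_operator\<close>).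
\<close>

section \<open>Finite differences\<close>

definition fdiff :: "nat \<Rightarrow> (real \<Rightarrow> real) \<Rightarrow> real \<Rightarrow> real" where
  "fdiff n f s = (\<Sum>i\<le>n. (-1) ^ (n + i) * real (n choose i) * f (s + real i))"

lemma fdiff_0 [simp]: "fdiff 0 f s = f s"
  by (simp add: fdiff_def)

lemma fdiff_Suc: "fdiff (Suc n) f s = fdiff n f (s + 1) - fdiff n f s"
proof -
  have "fdiff (Suc n) f s = (-1) ^ Suc n * f s +
      (\<Sum>i\<le>n. (-1) ^ (n + i) * real (Suc n choose Suc i) * f (s + 1 + real i))"
    unfolding fdiff_def
    by (subst sum.atMost_Suc_shift) (simp add: algebra_simps)
  also have "(\<Sum>i\<le>n. (-1) ^ (n + i) * real (Suc n choose Suc i) * f (s + 1 + real i)) =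
      fdiff n f (s + 1) + (\<Sum>i\<le>n. (-1) ^ (n + i) * real (n choose Suc i) * f (s + 1 + real i))"
    unfolding fdiff_def sum.distrib[symmetric]
    by (rule sum.cong) (auto simp: algebra_simps)
  also have "(\<Sum>i\<le>n. (-1) ^ (n + i) * real (n choose Suc i) * f (s + 1 + real i)) =
      - ((\<Sum>i\<le>Suc n. (-1) ^ (n + i) * real (n choose i) * f (s + real i)) - (-1) ^ n * f s)"
    by (subst sum.atMost_Suc_shift) (simp add: algebra_simps sum_negf)
  also have "(\<Sum>i\<le>Suc n. (-1) ^ (n + i) * real (n choose i) * f (s + real i)) = fdiff n f s"
    by (simp add: fdiff_def)
  finally show ?thesis by simp
qed

lemma fdiff_fdiff: "fdiff m (fdiff n f) s = fdiff (m + n) f s"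
  by (induction m arbitrary: s) (simp_all add: fdiff_Suc)

lemma fdiff_cmult: "fdiff n (\<lambda>x. c * f x) s = c * fdiff n f s"
  by (simp add: fdiff_def sum_distrib_left mult_ac)

text \<open>
  The derivative of a finite difference is the finite difference of the derivative, so the mean
  value theorem trades one order of differencing for one derivative. At the left end point
  \<open>f\<close> is merely continuous, like \<open>x powr r\<close> with \<open>0 < r < 1\<close> at \<open>0\<close>.
\<close>

lemma fdiff_mvt:
  assumes cont: "continuous_on {s..} f"
    and deriv: "\<And>x. x > s \<Longrightarrow> (f has_real_derivative f' x) (at x)"
  shows "\<exists>\<xi>>s. fdiff (Suc n) f s = fdiff n f' \<xi>"
proof -
  have c: "continuous_on {s..s + 1} (fdiff n f)"
    unfolding fdiff_def
    by (intro continuous_intros continuous_on_compose2[OF cont]) auto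
  have d: "(fdiff n f has_real_derivative fdiff n f' x) (at x)" if "x > s" for x
    unfolding fdiff_def
  proof (rule DERIV_sum)
    fix i
    have "((\<lambda>x. f (x + real i)) has_real_derivative f' (x + real i)) (at x)"
      using deriv[of "x + real i"] that by (simp add: DERIV_shift)
    then show "((\<lambda>s. (-1) ^ (n + i) * real (n choose i) * f (s + real i)) has_real_derivative
        (-1) ^ (n + i) * real (n choose i) * f' (x + real i)) (at x)"
      by (rule DERIV_cmult)
  qed
  obtain l z where z: "s < z" "z < s + 1" "DERIV (fdiff n f) z :> l"
      "fdiff n f (s + 1) - fdiff n f s = (s + 1 - s) * l"
    using MVT[of s "s + 1" "fdiff n f"] c d
    by (force simp: real_differentiable_def)
  have "l = fdiff n f' z"
    using z d DERIV_unique by blast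
  with z show ?thesis
    by (auto simp: fdiff_Suc)
qed

lemma fdiff_power_eq_0:
  assumes "m < n"
  shows "fdiff n (\<lambda>x. x ^ m) s = 0"
  using assms
proof (induction n arbitrary: m s)
  case 0
  then show ?case by simp
next
  case (Suc n)
  obtain \<xi> where "fdiff (Suc n) (\<lambda>x. x ^ m) s = fdiff n (\<lambda>x. real m * x ^ (m - 1)) \<xi>"
    using fdiff_mvt[of s "\<lambda>x. x ^ m" "\<lambda>x. real m * x ^ (m - 1)" n]
    by (force intro!: derivative_eq_intros continuous_intros)
  also have "\<dots> = real m * fdiff n (\<lambda>x. x ^ (m - 1)) \<xi>"
    by (rule fdiff_cmult)
  also have "\<dots> = 0"
    using Suc by (cases m) auto
  finally show ?case .
qed

lemma fdiff_powr_mvt: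
  assumes "s \<ge> 0" "r > 0"
  shows "\<exists>\<xi>>s. fdiff (Suc n) (\<lambda>x. x powr r) s = r * fdiff n (\<lambda>x. x powr (r - 1)) \<xi>"
proof -
  have "continuous_on {s..} (\<lambda>x. x powr r)"
    using assms by (intro continuous_on_powr') (auto intro!: continuous_intros)
  moreover have "((\<lambda>x. x powr r) has_real_derivative r * x powr (r - 1)) (at x)" if "x > s" for x
    using assms that by (intro has_real_derivative_powr) auto
  ultimately show ?thesis
    using fdiff_mvt[of s "\<lambda>x. x powr r" "\<lambda>x. r * x powr (r - 1)" n]
    by (simp add: fdiff_cmult)
qed

text \<open>
  By induction the difference is \<open>r (r - 1) \<dots> (r - n + 1) \<xi> powr (r - n)\<close> for some \<open>\<xi>\<close>, and all
  the factors are positive.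
\<close>

lemma fdiff_powr_pos:
  assumes "s > 0" "r > real n - 1"
  shows "fdiff n (\<lambda>x. x powr r) s > 0"
  using assms
proof (induction n arbitrary: r s)
  case 0
  then show ?case by simp
next
  case (Suc n)
  obtain \<xi> where "\<xi> > s" "fdiff (Suc n) (\<lambda>x. x powr r) s = r * fdiff n (\<lambda>x. x powr (r - 1)) \<xi>"
    using fdiff_powr_mvt[of s r n] Suc.prems by auto
  with Suc.IH[of \<xi> "r - 1"] Suc.prems show ?case
    by simp
qed

text \<open>
  One application of the mean value theorem moves the base point from \<open>0\<close> into the positive
  reals, whence \<open>n > 0\<close>; the difference of order \<open>0\<close> vanishes at \<open>0\<close>.
\<close>

lemma fdiff_powr_pos_at_0:
  assumes "n > 0" "r > real n - 1"
  shows "fdiff n (\<lambda>x. x powr r) 0 > 0"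
proof -
  obtain m where n: "n = Suc m"
    using assms gr0_implies_Suc by blast
  obtain \<xi> where "\<xi> > 0" "fdiff n (\<lambda>x. x powr r) 0 = r * fdiff m (\<lambda>x. x powr (r - 1)) \<xi>"
    using fdiff_powr_mvt[of 0 r m] assms n by auto
  with fdiff_powr_pos[of \<xi> m "r - 1"] assms n show ?thesis
    by simp
qed

section \<open>Configurations with vanishing moments\<close>

text \<open>
  The points are \<open>\<plusminus>\<surd>i\<close>, indexed by pairs of a sign and a number so that the origin may occur twice
  and no case distinction arises at \<open>i = 0\<close>. The square roots turn \<open>(x\<^sup>2 + y\<^sup>2)\<^sup>t\<close> into \<open>(i + j)\<^sup>t\<close>,
  and a double sum over \<open>i + j\<close> is an iterated difference.
\<close>

lemma exists_moment_free_configuration: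
  fixes t :: real and k :: nat
  assumes "k \<ge> 1" "2 * real k - 1 < t"
  obtains I :: "(real \<times> nat) set" and w p :: "real \<times> nat \<Rightarrow> real" where
    "finite I"
    "\<forall>m<2 * k. (\<Sum>i\<in>I. w i * p i ^ m) = 0"
    "(\<Sum>i\<in>I. \<Sum>j\<in>I. w i * w j * ((p i)\<^sup>2 + (p j)\<^sup>2) powr t) > 0"
proof -
  define I :: "(real \<times> nat) set" where "I = {1, -1} \<times> {..k}"
  define v where "v i = (-1) ^ (k + i) * real (k choose i)" for i
  define w :: "real \<times> nat \<Rightarrow> real" where "w = (\<lambda>(\<sigma>, i). v i)"
  define p :: "real \<times> nat \<Rightarrow> real" where "p = (\<lambda>(\<sigma>, i). \<sigma> * sqrt (real i))"
  have sum_I: "(\<Sum>i\<in>I. h i) = (\<Sum>i\<le>k. h (1, i)) + (\<Sum>i\<le>k. h (-1, i))"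
    for h :: "real \<times> nat \<Rightarrow> real"
    unfolding I_def by (subst sum.cartesian_product') simp
  have moments: "(\<Sum>i\<in>I. w i * p i ^ m) = 0" if "m < 2 * k" for m
  proof (cases "even m")
    case True
    then obtain l where l: "m = 2 * l" by blast
    have "(\<Sum>i\<le>k. v i * real i ^ l) = fdiff k (\<lambda>x. x ^ l) 0"
      by (simp add: fdiff_def v_def)
    also have "\<dots> = 0"
      using that l by (intro fdiff_power_eq_0) simp
    finally show ?thesis
      by (simp add: sum_I w_def p_def l power_mult)
  next
    case False
    then show ?thesis
      by (simp add: sum_I w_def p_def sum_negf)
  qed
  have "(\<Sum>i\<in>I. \<Sum>j\<in>I. w i * w j * ((p i)\<^sup>2 + (p j)\<^sup>2) powr t) =
      4 * (\<Sum>i\<le>k. \<Sum>j\<le>k. v i * v j * (real i + real j) powr t)"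
    by (simp add: sum_I w_def p_def sum.distrib sum_distrib_left)
  also have "(\<Sum>i\<le>k. \<Sum>j\<le>k. v i * v j * (real i + real j) powr t) =
      fdiff k (fdiff k (\<lambda>x. x powr t)) 0"
    by (simp add: fdiff_def v_def sum_distrib_left mult_ac)
  also have "\<dots> = fdiff (2 * k) (\<lambda>x. x powr t) 0"
    by (simp add: fdiff_fdiff mult_2)
  finally have "(\<Sum>i\<in>I. \<Sum>j\<in>I. w i * w j * ((p i)\<^sup>2 + (p j)\<^sup>2) powr t) > 0"
    using fdiff_powr_pos_at_0[of "2 * k" t] assms by simp
  with moments show ?thesis
    by (intro that[of I w p]) (auto simp: I_def)
qed

text \<open>
  In every term \<open>x\<^sup>m y\<^sup>2\<^sup>l\<^sup>-\<^sup>m\<close> of the binomial expansion one of the exponents is at most \<open>l < n\<close>,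
  so that one of the two factors of the double sum is a vanishing moment.
\<close>

lemma moment_free_difference_power:
  fixes w p :: "'i \<Rightarrow> real"
  assumes moments: "\<And>m. m < n \<Longrightarrow> (\<Sum>i\<in>I. w i * p i ^ m) = 0"
    and "l < n"
  shows "(\<Sum>i\<in>I. \<Sum>j\<in>I. w i * w j * ((p i - p j)\<^sup>2) ^ l) = 0"
proof -
  define b where "b m = real (2 * l choose m) * (-1) ^ (2 * l - m)" for m
  have "(\<Sum>i\<in>I. \<Sum>j\<in>I. w i * w j * ((p i - p j)\<^sup>2) ^ l) =
      (\<Sum>i\<in>I. \<Sum>j\<in>I. \<Sum>m\<le>2 * l. b m * ((w i * p i ^ m) * (w j * p j ^ (2 * l - m))))"
  proof (intro sum.cong refl)
    fix i j
    have "((p i - p j)\<^sup>2) ^ l = (p i + (- p j)) ^ (2 * l)"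
      by (simp add: power_mult)
    also have "\<dots> = (\<Sum>m\<le>2 * l. real (2 * l choose m) * p i ^ m * (- p j) ^ (2 * l - m))"
      by (rule binomial_ring)
    finally show "w i * w j * ((p i - p j)\<^sup>2) ^ l =
        (\<Sum>m\<le>2 * l. b m * ((w i * p i ^ m) * (w j * p j ^ (2 * l - m))))"
      by (simp add: b_def sum_distrib_left power_minus[of "p j"] mult_ac)
  qed
  also have "\<dots> = (\<Sum>m\<le>2 * l. b m *
      ((\<Sum>i\<in>I. w i * p i ^ m) * (\<Sum>j\<in>I. w j * p j ^ (2 * l - m))))"
    by (subst sum.swap, subst (2) sum.swap) (simp only: sum_product, simp only: sum_distrib_left)
  also have "\<dots> = 0"
  proof (intro sum.neutral ballI)
    fix m assume "m \<in> {..2 * l}"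
    then have "m < n \<or> 2 * l - m < n"
      using \<open>l < n\<close> by auto
    then show "b m * ((\<Sum>i\<in>I. w i * p i ^ m) * (\<Sum>j\<in>I. w j * p j ^ (2 * l - m))) = 0"
      using moments by auto
  qed
  finally show ?thesis .
qed

section \<open>Shrinking a configuration towards the origin\<close>

text \<open>
  Only \<open>A\<close>, the polynomial part of the denominator, is expanded in a geometric series. All terms
  with \<open>B\<close> stay in one remainder, which is asymptotic to \<open>B\<close>.
\<close>

lemma kernel_denominator_expansion:
  fixes A B :: real
  assumes "A \<ge> 0" "B \<ge> 0"
  shows "1 / (1 + A + B) = (\<Sum>l<n. (-1) ^ l * A ^ l) + (- A) ^ n / (1 + A) - B / ((1 + A) * (1 + A + B))"
proof -
  have "(\<Sum>l<n. (-1) ^ l * A ^ l) = (\<Sum>l<n. (- A) ^ l)"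
    by (simp add: power_minus[of A])
  also have "\<dots> = (1 - (- A) ^ n) / (1 + A)"
    using assms by (subst sum_gp_strict) auto
  finally have "(\<Sum>l<n. (-1) ^ l * A ^ l) + (- A) ^ n / (1 + A) = 1 / (1 + A)"
    by (simp add: diff_divide_distrib)
  moreover have "1 / (1 + A) - B / ((1 + A) * (1 + A + B)) = 1 / (1 + A + B)"
    using assms by (simp add: divide_simps)
  ultimately show ?thesis by simp
qed

text \<open>
  Shrinking by \<open>\<epsilon>\<close> multiplies \<open>(x - y)\<^sup>2\<close> by \<open>\<epsilon>\<^sup>2\<close> and \<open>(x\<^sup>2 + y\<^sup>2)\<^sup>t\<close> by \<open>\<epsilon>\<^sup>2\<^sup>t\<close>. The powers of
  \<open>(x - y)\<^sup>2\<close> below the \<open>n\<close>-th cancel, the remainder of the geometric series is of order \<open>\<epsilon>\<^sup>2\<^sup>n\<close>,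
  and since \<open>t < n\<close> the term of order \<open>\<epsilon>\<^sup>2\<^sup>t\<close> dominates.
\<close>

lemma kernel_scaling_limit:
  fixes t a :: real and w p :: "'i \<Rightarrow> real"
  assumes "a > 0" "t > 0" "t < real n"
    and moments: "\<And>m. m < n \<Longrightarrow> (\<Sum>i\<in>I. w i * p i ^ m) = 0"
  shows "((\<lambda>\<epsilon>. (\<Sum>i\<in>I. \<Sum>j\<in>I. w i * w j * (pi * K_kernel t a (\<epsilon> * p i) (\<epsilon> * p j))) / \<epsilon> powr (2 * t))
    \<longlongrightarrow> - a * (\<Sum>i\<in>I. \<Sum>j\<in>I. w i * w j * ((p i)\<^sup>2 + (p j)\<^sup>2) powr t)) (at_right 0)"
proof -
  define A where "A \<epsilon> i j = \<epsilon>\<^sup>2 * (p i - p j)\<^sup>2" for \<epsilon> i j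
  define N where "N i j = a * ((p i)\<^sup>2 + (p j)\<^sup>2) powr t" for i j
  define B where "B \<epsilon> i j = \<epsilon> powr (2 * t) * N i j" for \<epsilon> i j
  \<comment> \<open>the remainder of the expansion, divided by \<open>\<epsilon> powr (2 * t)\<close>\<close>
  define R where "R \<epsilon> i j = \<epsilon> powr (2 * n - 2 * t) * (- ((p i - p j)\<^sup>2)) ^ n / (1 + A \<epsilon> i j)
      - N i j / ((1 + A \<epsilon> i j) * (1 + A \<epsilon> i j + B \<epsilon> i j))" for \<epsilon> i j
  have N: "N i j \<ge> 0" for i j
    using \<open>a > 0\<close> by (simp add: N_def)
  have "(\<Sum>i\<in>I. \<Sum>j\<in>I. w i * w j * (pi * K_kernel t a (\<epsilon> * p i) (\<epsilon> * p j))) / \<epsilon> powr (2 * t) =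
      (\<Sum>i\<in>I. \<Sum>j\<in>I. w i * w j * R \<epsilon> i j)" if "\<epsilon> > 0" for \<epsilon>
  proof -
    have K: "pi * K_kernel t a (\<epsilon> * p i) (\<epsilon> * p j) =
        (\<Sum>l<n. (-1) ^ l * A \<epsilon> i j ^ l) + \<epsilon> powr (2 * t) * R \<epsilon> i j" for i j
    proof -
      have "((\<epsilon> * p i)\<^sup>2 + (\<epsilon> * p j)\<^sup>2) powr t = (\<epsilon>\<^sup>2 * ((p i)\<^sup>2 + (p j)\<^sup>2)) powr t"
        by (simp add: algebra_simps power_mult_distrib)
      also have "\<dots> = (\<epsilon> powr 2) powr t * ((p i)\<^sup>2 + (p j)\<^sup>2) powr t"
        using that by (subst powr_mult) auto
      also have "\<dots> = \<epsilon> powr (2 * t) * ((p i)\<^sup>2 + (p j)\<^sup>2) powr t"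
        by (simp add: powr_powr)
      finally have "a * ((\<epsilon> * p i)\<^sup>2 + (\<epsilon> * p j)\<^sup>2) powr t = B \<epsilon> i j"
        by (simp add: B_def N_def)
      moreover have "(\<epsilon> * p i - \<epsilon> * p j)\<^sup>2 = A \<epsilon> i j"
        by (simp add: A_def power2_eq_square algebra_simps)
      ultimately have "pi * K_kernel t a (\<epsilon> * p i) (\<epsilon> * p j) = 1 / (1 + A \<epsilon> i j + B \<epsilon> i j)"
        by (simp add: K_kernel_def)
      also have "\<dots> = (\<Sum>l<n. (-1) ^ l * A \<epsilon> i j ^ l) + (- A \<epsilon> i j) ^ n / (1 + A \<epsilon> i j)
          - B \<epsilon> i j / ((1 + A \<epsilon> i j) * (1 + A \<epsilon> i j + B \<epsilon> i j))"
        using N by (intro kernel_denominator_expansion) (auto simp: A_def B_def)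
      also have "(- A \<epsilon> i j) ^ n = (\<epsilon>\<^sup>2 * - ((p i - p j)\<^sup>2)) ^ n"
        by (simp add: A_def)
      also have "\<dots> = \<epsilon> ^ (2 * n) * (- ((p i - p j)\<^sup>2)) ^ n"
        by (simp only: power_mult_distrib power_mult)
      also have "\<epsilon> ^ (2 * n) = \<epsilon> powr (2 * t) * \<epsilon> powr (2 * n - 2 * t)"
        using that by (simp add: powr_add[symmetric] powr_realpow[symmetric])
      finally show ?thesis
        by (simp add: R_def B_def algebra_simps)
    qed
    have "(\<Sum>i\<in>I. \<Sum>j\<in>I. w i * w j * (\<Sum>l<n. (-1) ^ l * A \<epsilon> i j ^ l)) =
        (\<Sum>i\<in>I. \<Sum>j\<in>I. \<Sum>l<n. ((-1) ^ l * (\<epsilon>\<^sup>2) ^ l) * (w i * w j * ((p i - p j)\<^sup>2) ^ l))"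
      by (simp add: A_def sum_distrib_left power_mult_distrib mult_ac)
    also have "\<dots> = (\<Sum>l<n. ((-1) ^ l * (\<epsilon>\<^sup>2) ^ l) * (\<Sum>i\<in>I. \<Sum>j\<in>I. w i * w j * ((p i - p j)\<^sup>2) ^ l))"
      by (subst sum.swap, subst (2) sum.swap) (simp add: sum_distrib_left)
    also have "\<dots> = 0"
      by (simp add: moment_free_difference_power[OF moments])
    finally have poly: "(\<Sum>i\<in>I. \<Sum>j\<in>I. w i * w j * (\<Sum>l<n. (-1) ^ l * A \<epsilon> i j ^ l)) = 0" .
    have "(\<Sum>i\<in>I. \<Sum>j\<in>I. w i * w j * (pi * K_kernel t a (\<epsilon> * p i) (\<epsilon> * p j))) =
        (\<Sum>i\<in>I. \<Sum>j\<in>I. w i * w j * (\<Sum>l<n. (-1) ^ l * A \<epsilon> i j ^ l)) +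
        (\<Sum>i\<in>I. \<Sum>j\<in>I. \<epsilon> powr (2 * t) * (w i * w j * R \<epsilon> i j))"
      by (simp only: K distrib_left sum.distrib mult.left_commute[of "_ * _" "\<epsilon> powr (2 * t)"])
    also have "\<dots> = \<epsilon> powr (2 * t) * (\<Sum>i\<in>I. \<Sum>j\<in>I. w i * w j * R \<epsilon> i j)"
      by (simp only: poly add_0, simp only: sum_distrib_left)
    finally show ?thesis
      using that by simp
  qed
  then have ev: "\<forall>\<^sub>F \<epsilon> in at_right 0. (\<Sum>i\<in>I. \<Sum>j\<in>I. w i * w j * R \<epsilon> i j) =
      (\<Sum>i\<in>I. \<Sum>j\<in>I. w i * w j * (pi * K_kernel t a (\<epsilon> * p i) (\<epsilon> * p j))) / \<epsilon> powr (2 * t)"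
    by (auto intro!: eventually_at_right_less[THEN eventually_mono])
  have id: "((\<lambda>\<epsilon>. \<epsilon>) \<longlongrightarrow> (0::real)) (at_right 0)"
    by (rule tendsto_ident_at)
  have z: "((\<lambda>\<epsilon>. \<epsilon> powr s) \<longlongrightarrow> (0::real)) (at_right 0)" if "s > 0" for s
    using tendsto_powr'[OF id tendsto_const[of s]] that
    by (simp add: eventually_at_right_less[THEN eventually_mono])
  have Alim: "((\<lambda>\<epsilon>. A \<epsilon> i j) \<longlongrightarrow> 0) (at_right 0)" for i j
    unfolding A_def by (auto intro!: tendsto_eq_intros id)
  have Blim: "((\<lambda>\<epsilon>. B \<epsilon> i j) \<longlongrightarrow> 0) (at_right 0)" for i j
    unfolding B_def using z[of "2 * t"] \<open>t > 0\<close> by (auto intro: tendsto_mult_left_zero)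
  have Rlim: "((\<lambda>\<epsilon>. R \<epsilon> i j) \<longlongrightarrow> 0 * (- ((p i - p j)\<^sup>2)) ^ n / (1 + 0) - N i j / ((1 + 0) * (1 + 0 + 0)))
      (at_right 0)" for i j
    unfolding R_def using z[of "2 * n - 2 * t"] \<open>t < n\<close>
    by (intro tendsto_intros Alim Blim) auto
  have "((\<lambda>\<epsilon>. \<Sum>i\<in>I. \<Sum>j\<in>I. w i * w j * R \<epsilon> i j) \<longlongrightarrow>
      (\<Sum>i\<in>I. \<Sum>j\<in>I. w i * w j * (0 * (- ((p i - p j)\<^sup>2)) ^ n / (1 + 0) - N i j / ((1 + 0) * (1 + 0 + 0)))))
      (at_right 0)"
    by (intro tendsto_sum tendsto_mult_left Rlim)
  also have "(\<Sum>i\<in>I. \<Sum>j\<in>I. w i * w j * (0 * (- ((p i - p j)\<^sup>2)) ^ n / (1 + 0) - N i j / ((1 + 0) * (1 + 0 + 0)))) =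
     - a * (\<Sum>i\<in>I. \<Sum>j\<in>I. w i * w j * ((p i)\<^sup>2 + (p j)\<^sup>2) powr t)"
    by (simp add: N_def sum_distrib_left sum_negf mult_ac)
  finally show ?thesis
    using ev by (rule Lim_transform_eventually)
qed

section \<open>From weighted points to kernels and operators\<close>

lemma positive_definite_kernel_finite_sum:
  assumes "positive_definite_kernel X K" "finite I" "\<And>i. i \<in> I \<Longrightarrow> q i \<in> X"
  shows "(\<Sum>i\<in>I. \<Sum>j\<in>I. w i * cnj (w j) * K (q i) (q j)) \<in> \<real>\<^sub>\<ge>\<^sub>0"
proof (cases "I = {}")
  case False
  obtain h where h: "bij_betw h {1..card I} I"
    using ex_bij_betw_nat_finite_1[OF \<open>finite I\<close>] by blast
  have "card I \<ge> 1"
    using False \<open>finite I\<close> by (simp add: Suc_le_eq card_gt_0_iff)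
  moreover have "\<forall>j\<in>{1..card I}. (q \<circ> h) j \<in> X"
    using h assms(3) by (auto dest: bij_betwE)
  ultimately have "(\<Sum>i=1..card I. \<Sum>j=1..card I.
      (w \<circ> h) i * cnj ((w \<circ> h) j) * K ((q \<circ> h) i) ((q \<circ> h) j)) \<in> \<real>\<^sub>\<ge>\<^sub>0"
    using assms(1) unfolding positive_definite_kernel_def by blast
  also have "(\<Sum>i=1..card I. \<Sum>j=1..card I.
      (w \<circ> h) i * cnj ((w \<circ> h) j) * K ((q \<circ> h) i) ((q \<circ> h) j)) =
      (\<Sum>i=1..card I. \<Sum>j\<in>I. w (h i) * cnj (w j) * K (q (h i)) (q j))"
    by (intro sum.cong refl) (subst sum.reindex_bij_betw[OF h, symmetric], simp)
  also have "\<dots> = (\<Sum>i\<in>I. \<Sum>j\<in>I. w i * cnj (w j) * K (q i) (q j))"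
    by (rule sum.reindex_bij_betw[OF h])
  finally show ?thesis .
qed simp

lemma box_integral_approx:
  fixes K :: "real \<Rightarrow> real \<Rightarrow> real"
  assumes cont: "continuous_on UNIV (\<lambda>z. K (fst z) (snd z))"
    and "\<delta> \<ge> 0"
    and close: "\<And>x y. x \<in> {u..u + \<delta>} \<Longrightarrow> y \<in> {v..v + \<delta>} \<Longrightarrow> \<bar>K x y - K u v\<bar> \<le> \<eta>"
  defines "F \<equiv> \<lambda>z. indicator ({u..u + \<delta>} \<times> {v..v + \<delta>}) z * K (fst z) (snd z)"
  shows "integrable lborel F" (is ?int)
    and "\<bar>integral\<^sup>L lborel F - \<delta>\<^sup>2 * K u v\<bar> \<le> \<eta> * \<delta>\<^sup>2" (is ?bound)
proof -
  let ?S = "{u..u + \<delta>} \<times> {v..v + \<delta>}"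
  have S: "?S = cbox (u, v) (u + \<delta>, v + \<delta>)"
    by (simp only: cbox_Pair_eq box_real)
  have "set_integrable lborel ?S (\<lambda>z. K (fst z) (snd z))"
    unfolding S set_integrable_def
    by (intro borel_integrable_compact continuous_on_subset[OF cont] compact_cbox) auto
  then show F: ?int
    by (simp add: F_def set_integrable_def)
  have m: "measure lborel ?S = \<delta>\<^sup>2"
    unfolding S using \<open>\<delta> \<ge> 0\<close>
    by (subst measure_lborel_cbox_eq) (auto simp: Basis_prod_def prod.union_disjoint power2_eq_square)
  have fin: "emeasure lborel ?S < \<infinity>"
    unfolding S using emeasure_lborel_cbox_finite by blast
  have meas: "?S \<in> sets lborel"
    unfolding S by simp
  have cI: "integrable lborel (\<lambda>z. indicator ?S z * c)" for c :: real
    using fin meas by (intro integrable_mult_left integrable_real_indicator) auto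
  have cv: "integral\<^sup>L lborel (\<lambda>z. indicator ?S z * c) = \<delta>\<^sup>2 * c" for c :: real
    using m by simp
  have "integral\<^sup>L lborel F - \<delta>\<^sup>2 * K u v = integral\<^sup>L lborel (\<lambda>z. F z - indicator ?S z * K u v)"
    using F cI[of "K u v"] cv[of "K u v"] by (subst Bochner_Integration.integral_diff) auto
  also have "\<bar>\<dots>\<bar> \<le> integral\<^sup>L lborel (\<lambda>z. indicator ?S z * \<eta>)"
    using F cI close
    by (intro integral_abs_bound_integral Bochner_Integration.integrable_diff)
      (auto simp: F_def indicator_def split: if_splits)
  also have "\<dots> = \<eta> * \<delta>\<^sup>2"
    by (simp only: cv mult.commute[of \<eta>])
  finally show ?bound .
qed

lemma eventually_near_point_values:
  fixes K :: "real \<Rightarrow> real \<Rightarrow> real"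
  assumes cont: "continuous_on UNIV (\<lambda>z. K (fst z) (snd z))" and "\<eta> > 0"
  shows "\<forall>\<^sub>F \<delta> in at_right 0. \<forall>x\<in>{u..u + \<delta>}. \<forall>y\<in>{v..v + \<delta>}. \<bar>K x y - K u v\<bar> \<le> \<eta>"
proof -
  have "isCont (\<lambda>z. K (fst z) (snd z)) (u, v)"
    using cont by (simp add: continuous_on_eq_continuous_at)
  then obtain d where d: "d > 0"
      "\<And>z. dist z (u, v) < d \<Longrightarrow> \<bar>K (fst z) (snd z) - K u v\<bar> < \<eta>"
    using \<open>\<eta> > 0\<close> unfolding continuous_at_eps_delta by (fastforce simp: dist_real_def)
  have "\<bar>K x y - K u v\<bar> \<le> \<eta>"
    if "\<delta> \<in> {0<..<d / 2}" "x \<in> {u..u + \<delta>}" "y \<in> {v..v + \<delta>}" for \<delta> x y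
  proof -
    have "dist (x, y) (u, v) \<le> \<bar>dist x u\<bar> + \<bar>dist y v\<bar>"
      unfolding dist_Pair_Pair by (rule sqrt_sum_squares_le_sum_abs)
    also have "\<dots> < d"
      using that by (auto simp: dist_real_def)
    finally show ?thesis
      using d(2)[of "(x, y)"] by simp
  qed
  moreover have "\<forall>\<^sub>F \<delta> in at_right 0. \<delta> \<in> {0<..<d / 2}"
    using d by (intro eventually_at_right_real) auto
  ultimately show ?thesis
    by (auto elim!: eventually_mono)
qed

text \<open>
  The test function is \<open>\<Sum>\<^sub>i w\<^sub>i 1\<^bsub>[p\<^sub>i, p\<^sub>i + \<delta>]\<^esub>\<close>. Its quadratic form is \<open>\<delta>\<^sup>2\<close> times the given negative
  double sum, up to the oscillation of the kernel on the squares
  \<open>[p\<^sub>i, p\<^sub>i + \<delta>] \<times> [p\<^sub>j, p\<^sub>j + \<delta>]\<close>, which is small by continuity.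
\<close>

lemma negative_quadratic_form_imp_not_positive_definite_operator:
  fixes K :: "real \<Rightarrow> real \<Rightarrow> real" and w p :: "'i \<Rightarrow> real"
  assumes "finite I"
    and cont: "continuous_on UNIV (\<lambda>z. K (fst z) (snd z))"
    and neg: "(\<Sum>i\<in>I. \<Sum>j\<in>I. w i * w j * K (p i) (p j)) < 0" (is "?S < 0")
  shows "\<not> positive_definite_operator (integral_operator (\<lambda>x y. complex_of_real (K x y)))"
proof -
  define W where "W = (\<Sum>i\<in>I. \<Sum>j\<in>I. \<bar>w i * w j\<bar>)"
  \<comment> \<open>chosen so that an error of \<open>\<eta>\<close> in each kernel value changes the double sum by at most half
    of its modulus; the \<open>1\<close> avoids division by \<open>0\<close>\<close>
  define \<eta> where "\<eta> = - ?S / (2 * (W + 1))"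
  have W: "W \<ge> 0"
    unfolding W_def by (intro sum_nonneg) auto
  have \<eta>: "\<eta> > 0"
    using neg W by (simp add: \<eta>_def divide_neg_pos)
  have "\<forall>\<^sub>F \<delta> in at_right (0::real). \<delta> > 0 \<and> (\<forall>i\<in>I. \<forall>j\<in>I.
      \<forall>x\<in>{p i..p i + \<delta>}. \<forall>y\<in>{p j..p j + \<delta>}. \<bar>K x y - K (p i) (p j)\<bar> \<le> \<eta>)"
    by (intro eventually_conj eventually_at_right_less eventually_ball_finite ballI \<open>finite I\<close>
        eventually_near_point_values cont \<eta>)
  then obtain \<delta> where \<delta>: "\<delta> > 0" and
    close: "\<And>i j x y. \<lbrakk>i \<in> I; j \<in> I; x \<in> {p i..p i + \<delta>}; y \<in> {p j..p j + \<delta>}\<rbrakk>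
      \<Longrightarrow> \<bar>K x y - K (p i) (p j)\<bar> \<le> \<eta>"
    using eventually_happens'[OF trivial_limit_at_right_real] by blast
  define J where "J i = {p i..p i + \<delta>}" for i
  define c where "c x = (\<Sum>i\<in>I. w i * indicator (J i) x)" for x
  define F where "F i j z = indicator (J i \<times> J j) z * K (fst z) (snd z)" for i j and z :: "real \<times> real"
  have F: "integrable lborel (F i j)"
      "\<bar>integral\<^sup>L lborel (F i j) - \<delta>\<^sup>2 * K (p i) (p j)\<bar> \<le> \<eta> * \<delta>\<^sup>2" if "i \<in> I" "j \<in> I" for i j
    unfolding F_def[abs_def] J_def
    using box_integral_approx[OF cont less_imp_le[OF \<delta>] close[OF that]] by auto
  \<comment> \<open>the integrand of the quadratic form, as a function on the plane, where Fubini applies\<close>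
  define G where "G z = (\<Sum>i\<in>I. \<Sum>j\<in>I. w i * w j * F i j z)" for z
  have G_eq: "G (x, y) = K x y * c y * c x" for x y
  proof -
    have "c x * c y = (\<Sum>i\<in>I. \<Sum>j\<in>I. w i * w j * indicator (J i \<times> J j) (x, y))"
      by (simp add: c_def sum_product indicator_times mult_ac)
    then have "K x y * c y * c x =
        K x y * (\<Sum>i\<in>I. \<Sum>j\<in>I. w i * w j * indicator (J i \<times> J j) (x, y))"
      by (simp add: mult_ac)
    then show ?thesis
      by (simp add: G_def F_def sum_distrib_left mult_ac)
  qed
  have G: "integrable lborel G"
    unfolding G_def using F by (intro Bochner_Integration.integrable_sum integrable_mult_right) auto
  have "integral\<^sup>L lborel G = (\<Sum>i\<in>I. \<Sum>j\<in>I. w i * w j * integral\<^sup>L lborel (F i j))"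
    unfolding G_def using F by (simp add: Bochner_Integration.integral_sum)
  also have "\<dots> \<le> (\<Sum>i\<in>I. \<Sum>j\<in>I. \<delta>\<^sup>2 * (w i * w j * K (p i) (p j)) + \<eta> * \<delta>\<^sup>2 * \<bar>w i * w j\<bar>)"
  proof (intro sum_mono)
    fix i j assume ij: "i \<in> I" "j \<in> I"
    have "w i * w j * (integral\<^sup>L lborel (F i j) - \<delta>\<^sup>2 * K (p i) (p j)) \<le>
        \<bar>w i * w j\<bar> * (\<eta> * \<delta>\<^sup>2)"
      by (rule order_trans[OF abs_ge_self], unfold abs_mult[of "w i * w j"],
          rule mult_left_mono[OF F(2)[OF ij] abs_ge_zero])
    then show "w i * w j * integral\<^sup>L lborel (F i j) \<le>
        \<delta>\<^sup>2 * (w i * w j * K (p i) (p j)) + \<eta> * \<delta>\<^sup>2 * \<bar>w i * w j\<bar>"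
      by (simp add: algebra_simps)
  qed
  also have "\<dots> = \<delta>\<^sup>2 * (?S + \<eta> * W)"
    by (simp add: W_def sum.distrib sum_distrib_left algebra_simps)
  also have "\<dots> < 0"
  proof -
    have "\<eta> * W \<le> \<eta> * (W + 1)"
      using \<eta> by simp
    also have "\<dots> = - ?S / 2"
      using W by (simp add: \<eta>_def field_simps)
    finally have "?S + \<eta> * W < 0"
      using neg by linarith
    then show ?thesis
      using \<delta> by (simp add: mult_pos_neg)
  qed
  finally have int_neg: "integral\<^sup>L lborel G < 0" .
  have "L2_inner (integral_operator (\<lambda>x y. complex_of_real (K x y)) (\<lambda>x. complex_of_real (c x)))
      (\<lambda>x. complex_of_real (c x)) = complex_of_real (LINT x|lborel. (LINT y|lborel. K x y * c y) * c x)"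
    by (simp add: L2_inner_def integral_operator_def integral_complex_of_real flip: of_real_mult)
  also have "(LINT x|lborel. (LINT y|lborel. K x y * c y) * c x) =
      (LINT x|lborel. (LINT y|lborel. G (x, y)))"
    by (simp add: G_eq)
  also have "\<dots> = integral\<^sup>L lborel G"
    using lborel_pair.integral_fst'[of G] G by (simp add: lborel_prod)
  finally have "L2_inner (integral_operator (\<lambda>x y. complex_of_real (K x y)) (\<lambda>x. complex_of_real (c x)))
      (\<lambda>x. complex_of_real (c x)) \<notin> \<real>\<^sub>\<ge>\<^sub>0"
    using int_neg by simp
  moreover have "(\<lambda>x. complex_of_real (c x)) \<in> L2"
  proof -
    have "(cmod (complex_of_real (c x)))\<^sup>2 =
        (\<Sum>i\<in>I. \<Sum>j\<in>I. w i * w j * indicator (J i \<inter> J j) x)" for x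
    proof -
      have "(cmod (complex_of_real (c x)))\<^sup>2 = c x * c x"
        by (simp add: power2_eq_square)
      also have "\<dots> = (\<Sum>i\<in>I. \<Sum>j\<in>I. w i * w j * indicator (J i \<inter> J j) x)"
        by (simp add: c_def sum_product indicator_inter_arith mult_ac)
      finally show ?thesis .
    qed
    moreover have "integrable lborel (\<lambda>x. \<Sum>i\<in>I. \<Sum>j\<in>I. w i * w j * indicator (J i \<inter> J j) x)"
      by (intro Bochner_Integration.integrable_sum integrable_mult_right integrable_real_indicator)
        (auto simp: J_def intro!: emeasure_compact_finite[unfolded infinity_ennreal_def])
    ultimately show ?thesis
      by (auto simp: L2_def c_def J_def)
  qed
  ultimately show ?thesis
    unfolding positive_definite_operator_def by blast
qed

lemma continuous_K_kernel:
  assumes "a \<ge> 0" "t > 0"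
  shows "continuous_on UNIV (\<lambda>z. K_kernel t a (fst z) (snd z))"
proof -
  have "1 + (x - y)\<^sup>2 + a * (x\<^sup>2 + y\<^sup>2) powr t \<noteq> 0" for x y :: real
    using assms by (smt (verit) mult_nonneg_nonneg powr_ge_zero zero_le_power2)
  then show ?thesis
    unfolding K_kernel_def using assms
    by (intro continuous_intros continuous_on_powr') auto
qed

theorem theorem3:
  fixes t a :: real
  assumes "t \<in> (\<Union>k\<in>{1::nat..}. {2 * real k - 1 <..< 2 * real k})"
    and "a > 0"
  shows "\<not> positive_definite_kernel (UNIV :: real set)
             (\<lambda>x y. complex_of_real (K_kernel t a x y))
       \<and> \<not> positive_definite_operator
             (integral_operator (\<lambda>x y. complex_of_real (K_kernel t a x y)))"
proof -
  obtain k :: nat where k: "k \<ge> 1" "2 * real k - 1 < t" "t < real (2 * k)"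
    using assms(1) by auto
  then have "t > 0"
    by linarith
  obtain I :: "(real \<times> nat) set" and w p :: "real \<times> nat \<Rightarrow> real" where I: "finite I"
    and moments: "\<forall>m<2 * k. (\<Sum>i\<in>I. w i * p i ^ m) = 0"
    and pos: "(\<Sum>i\<in>I. \<Sum>j\<in>I. w i * w j * ((p i)\<^sup>2 + (p j)\<^sup>2) powr t) > 0"
    by (rule exists_moment_free_configuration[OF k(1,2)])
  have "\<forall>\<^sub>F \<epsilon> in at_right 0.
      (\<Sum>i\<in>I. \<Sum>j\<in>I. w i * w j * (pi * K_kernel t a (\<epsilon> * p i) (\<epsilon> * p j))) / \<epsilon> powr (2 * t) < 0"
    using kernel_scaling_limit[OF \<open>a > 0\<close> \<open>t > 0\<close> k(3)] moments pos \<open>a > 0\<close>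
    by (intro order_tendstoD(2)) (auto simp: mult_neg_pos)
  then obtain \<epsilon> where
    "(\<Sum>i\<in>I. \<Sum>j\<in>I. w i * w j * (pi * K_kernel t a (\<epsilon> * p i) (\<epsilon> * p j))) / \<epsilon> powr (2 * t) < 0"
    using eventually_happens'[OF trivial_limit_at_right_real] by blast
  then have "pi * (\<Sum>i\<in>I. \<Sum>j\<in>I. w i * w j * K_kernel t a (\<epsilon> * p i) (\<epsilon> * p j)) < 0"
    by (simp add: divide_less_0_iff sum_distrib_left mult_ac)
  then have neg: "(\<Sum>i\<in>I. \<Sum>j\<in>I. w i * w j * K_kernel t a (\<epsilon> * p i) (\<epsilon> * p j)) < 0"
    by (simp add: mult_less_0_iff)
  have "\<not> positive_definite_kernel UNIV (\<lambda>x y. complex_of_real (K_kernel t a x y))"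
  proof
    assume "positive_definite_kernel UNIV (\<lambda>x y. complex_of_real (K_kernel t a x y))"
    then have "(\<Sum>i\<in>I. \<Sum>j\<in>I. complex_of_real (w i) * cnj (complex_of_real (w j)) *
        complex_of_real (K_kernel t a (\<epsilon> * p i) (\<epsilon> * p j))) \<in> \<real>\<^sub>\<ge>\<^sub>0"
      using I by (rule positive_definite_kernel_finite_sum) simp
    then have "complex_of_real (\<Sum>i\<in>I. \<Sum>j\<in>I. w i * w j * K_kernel t a (\<epsilon> * p i) (\<epsilon> * p j)) \<in> \<real>\<^sub>\<ge>\<^sub>0"
      by simp
    with neg show False
      by (simp only: nonneg_Reals_of_real_iff)
  qed
  moreover have "\<not> positive_definite_operator
      (integral_operator (\<lambda>x y. complex_of_real (K_kernel t a x y)))"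
    using I continuous_K_kernel[of a t] neg \<open>a > 0\<close> \<open>t > 0\<close>
    by (intro negative_quadratic_form_imp_not_positive_definite_operator) auto
  ultimately show ?thesis ..
qed

end
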